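(* Let $n\ge1$ and, for $i=1,\dots,n$, let $\gamma_i>0$, $\epsilon_i>0$, and let $G_i$ be a CDF on $\mathbb{R}$ with finite second moment, mean $\mu_i$ and variance $\sigma_i^2>0$. Consider the problem $$\inf_{\bm w\in\Delta_n}\left\{\sum_{i=1}^n\ \sup_{F_i\in\mathcal{M}^2(G_i;\epsilon_i)}V_i^{F_i}(w_iX;\gamma_i)\right\}.\qquad(\ast)$$ Then $$\inf_{\bm w\in\Delta_n}\left\{\sum_{i=1}^n\sup_{F_i\in\mathcal{M}^2(G_i;\epsilon_i)}V_i^{F_i}(w_iX;\gamma_i)\right\}=\inf_{\bm\lambda>\bm\gamma}\ \inf_{\bm w\in\Delta_n}\ \sum_{i=1}^n\left\{\left(\frac{\lambda_i\gamma_i}{\lambda_i-\gamma_i}\sigma_i^2+\lambda_i\epsilon_i\right)w_i^2+\mu_iw_i+\frac{1}{4\lambda_i}\right\}.$$ Furthermore, if $\mu_1=\cdots=\mu_n=\mu$, the optimal proportions that solve problem $(\ast)$ are $$w_i^*=\frac{\left(\frac{\lambda_i^*\gamma_i}{\lambda_i^*-\gamma_i}\sigma_i^2+\lambda_i^*\epsilon_i\right)^{-1}}{\sum_{k=1}^n\left(\frac{\lambda_k^*\gamma_k}{\lambda_k^*-\gamma_k}\sigma_k^2+\lambda_k^*\epsilon_k\right)^{-1}},\qquad i=1,\dots,n,$$ where $\bm\lambda^*=(\lambda_1^*,\dots,\lambda_n^* )$ is a minimizer, $$\bm\lambda^*=\operatorname*{arg\,inf}_{\bm\lambda>\bm\g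amma}\left\{\left(\sum_{k=1}^n\frac{1}{\frac{\lambda_k\gamma_k}{\lambda_k-\gamma_k}\sigma_k^2+\lambda_k\epsilon_k}\right)^{-1}+\sum_{k=1}^n\frac{1}{4\lambda_k}\right\}.$$
   Context: $\Delta_n=\{\bm w\in\mathbb{R}^n:w_i\ge0,\ \sum_{i=1}^nw_i=1\}$. $\bm\lambda=(\lambda_1,\dots,\lambda_n)$, $\bm\gamma=(\gamma_1,\dots,\gamma_n)$, and $\bm\lambda>\bm\gamma$ means $\lambda_i>\gamma_i$ for every $i$. For a CDF $F$, $F^{-1}(t)=\inf\{x:F(x)\ge t\}$; $W_2(F,G)=\left(\int_0^1|F^{-1}(t)-G^{-1}(t)|^2dt\right)^{1/2}$; $\mathcal{M}^2(G;\epsilon)$ is the set of all CDFs $F$ with finite second moment and $W_2(F,G)\le\sqrt{\epsilon}$. $V_i^{F_i}(w_iX;\gamma_i)$ is the mean plus $\gamma_i$ times the variance of $w_iX$ when $X$ has CDF $F_i$, i.e. $V_i^{F_i}(w_iX;\gamma_i)=w_i\mu_{F_i}+\gamma_iw_i^2\sigma_{F_i}^2$, with $\mu_{F_i},\sigma_{F_i}^2$ the mean and variance of $F_i$. *)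

theory Defs
  imports "HOL-Probability.Probability"
begin

definition is_cdf :: "(real \<Rightarrow> real) \<Rightarrow> bool" where
  "is_cdf F \<longleftrightarrow> (\<exists>M. real_distribution M \<and> F = cdf M)"

text \<open>For a CDF \<open>F\<close>, \<open>interval_measure F\<close> is the unique Borel probability measure with
  distribution function \<open>F\<close>, i.e. the law of a random variable \<open>X\<close> with CDF \<open>F\<close>.\<close>

definition finite_second_moment :: "(real \<Rightarrow> real) \<Rightarrow> bool" where
  "finite_second_moment F \<longleftrightarrow> integrable (interval_measure F) (\<lambda>x. x\<^sup>2)"

definition cdf_mean :: "(real \<Rightarrow> real) \<Rightarrow> real" where
  "cdf_mean F = prob_space.expectation (interval_measure F) (\<lambda>x. x)"

definition cdf_variance :: "(real \<Rightarrow> real) \<Rightarrow> real" where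
  "cdf_variance F = prob_space.variance (interval_measure F) (\<lambda>x. x)"

definition mean_variance :: "(real \<Rightarrow> real) \<Rightarrow> real \<Rightarrow> real \<Rightarrow> real" where
  "mean_variance F w \<gamma> =
     prob_space.expectation (interval_measure F) (\<lambda>x. w * x)
     + \<gamma> * prob_space.variance (interval_measure F) (\<lambda>x. w * x)"

definition quantile :: "(real \<Rightarrow> real) \<Rightarrow> real \<Rightarrow> real" where
  "quantile F t = Inf {x. F x \<ge> t}"

text \<open>The integrand is Lebesgue integrable whenever both CDFs have finite second moment; the
  distance is only used for such CDFs. The endpoints 0 and 1, where the infimum defining the
  quantile need not be finite, form a null set and are left out.\<close>

definition wasserstein2 :: "(real \<Rightarrow> real) \<Rightarrow> (real \<Rightarrow> real) \<Rightarrow> real" where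
  "wasserstein2 F G =
     sqrt (set_lebesgue_integral lborel {0<..<1} (\<lambda>t. \<bar>quantile F t - quantile G t\<bar>\<^sup>2))"

definition wasserstein_ball :: "(real \<Rightarrow> real) \<Rightarrow> real \<Rightarrow> (real \<Rightarrow> real) set" where
  "wasserstein_ball G \<epsilon> =
     {F. is_cdf F \<and> finite_second_moment F \<and> wasserstein2 F G \<le> sqrt \<epsilon>}"

definition simplex_weights :: "(real ^ 'n) set" where
  "simplex_weights = {w. (\<forall>i. 0 \<le> w $ i) \<and> (\<Sum>i\<in>UNIV. w $ i) = 1}"

text \<open>This is strict inequality in every coordinate; the order \<open><\<close> of the type \<open>real ^ 'n\<close>
  is the strict part of the componentwise order and hence weaker.\<close>

definition above :: "real ^ 'n \<Rightarrow> (real ^ 'n) set" where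
  "above \<gamma> = {l. \<forall>i. \<gamma> $ i < l $ i}"

text \<open>Suprema and infima are taken in the extended reals, so that they are meaningful without a
  boundedness assumption.\<close>

definition worst_case_objective ::
    "('n::finite \<Rightarrow> real \<Rightarrow> real) \<Rightarrow> real ^ 'n \<Rightarrow> real ^ 'n \<Rightarrow> real ^ 'n \<Rightarrow> ereal" where
  "worst_case_objective G \<epsilon> \<gamma> w =
     (\<Sum>i\<in>UNIV. SUP F\<in>wasserstein_ball (G i) (\<epsilon> $ i). ereal (mean_variance F (w $ i) (\<gamma> $ i)))"

definition dual_coeff :: "real ^ 'n \<Rightarrow> real ^ 'n \<Rightarrow> real ^ 'n \<Rightarrow> real ^ 'n \<Rightarrow> 'n \<Rightarrow> real" where
  "dual_coeff \<gamma> \<epsilon> \<sigma> l i =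
     l $ i * \<gamma> $ i / (l $ i - \<gamma> $ i) * (\<sigma> $ i)\<^sup>2 + l $ i * \<epsilon> $ i"

end

theory Submission
  imports Defs "HOL-Real_Asymp.Real_Asymp"
begin

text \<open>Couple \<open>F\<close> and \<open>G\<close> through their quantile functions on \<open>(0, 1)\<close>. The pointwise estimate
  \<open>\<gamma> (x + y)\<^sup>2 \<le> l \<gamma> / (l - \<gamma>) x\<^sup>2 + l y\<^sup>2\<close> applied to the centred quantile functions, together with
  \<open>w a \<le> l w\<^sup>2 a\<^sup>2 + 1 / (4 l)\<close> for the difference \<open>a\<close> of the means, gives weak duality. For \<open>w > 0\<close> an
  affine image of \<open>G\<close> and a suitable \<open>l > \<gamma>\<close> give equality; for \<open>w = 0\<close> let \<open>l\<close> tend to infinity.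
  The problem is separable, so the infima over the \<open>l\<^sub>i\<close> may be taken jointly and exchanged with
  the one over \<open>w\<close>. If all means agree, the inner quadratic problem is solved by completing the
  square, which shows that \<open>w\<^sup>*\<close> is optimal. It is the only optimum because the worst-case value is
  strictly convex: the extremal distribution at a midpoint is admissible at both end points and has
  positive variance.\<close>

section \<open>Quantile functions as random variables on the unit interval\<close>

abbreviation uniform01 :: "real measure" where
  "uniform01 \<equiv> restrict_space lborel {0<..<1}"

interpretation uniform01: prob_space uniform01
  by (auto simp: space_restrict_space emeasure_restrict_space intro!: prob_spaceI)

lemma interval_measure_cdf:
  assumes "real_distribution M"
  shows "interval_measure (cdf M) = M"
proof -
  interpret real_distribution M by fact
  note cdf = cdf_nondecreasing cdf_is_right_cont cdf_lim_at_top_prob cdf_lim_at_bot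
  show ?thesis
    by (intro cdf_unique real_distribution_interval_measure cdf_interval_measure cdf assms)
qed

text \<open>For \<open>t\<close> strictly between 0 and 1 the set in the infimum is nonempty,
  bounded below and, by right continuity, closed, so its infimum is a minimum.\<close>

lemma quantile_le_iff:
  assumes "is_cdf F" "t \<in> {0<..<1}"
  shows "quantile F t \<le> x \<longleftrightarrow> t \<le> F x"
proof -
  obtain M where "real_distribution M" and F: "F = cdf M"
    using assms by (auto simp: is_cdf_def)
  then interpret cdf_distribution M
    by (simp add: cdf_distribution_def)
  show ?thesis
    using pseudoinverse[of t x] assms(2) by (simp add: quantile_def F)
qed

lemma quantile_measurable:
  assumes "is_cdf F"
  shows "quantile F \<in> borel_measurable uniform01"
proof -
  have "mono_on {0<..<1} (quantile F)"
  proof (rule mono_onI)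
    fix s t :: real
    assume st: "s \<in> {0<..<1}" "t \<in> {0<..<1}" "s \<le> t"
    then have "t \<le> F (quantile F t)"
      using quantile_le_iff[OF assms] by blast
    with st show "quantile F s \<le> quantile F t"
      using quantile_le_iff[OF assms] by simp
  qed
  then have "quantile F \<in> borel_measurable (restrict_space borel {0<..<1})"
    by (rule borel_measurable_mono_on_fnc)
  then show ?thesis
    by (simp add: measurable_cong_sets[OF sets_restrict_space_cong[OF sets_lborel] refl])
qed

text \<open>Inverse transform sampling. It moves the moments of all CDFs to the single space
  \<open>uniform01\<close>, where different CDFs can be compared pointwise.\<close>

lemma distr_quantile:
  assumes "is_cdf F"
  shows "distr uniform01 borel (quantile F) = interval_measure F"
proof -
  obtain M where M: "real_distribution M" and F: "F = cdf M"
    using assms by (auto simp: is_cdf_def)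
  then interpret cdf_distribution M
    by (simp add: cdf_distribution_def)
  show ?thesis
    using distr_I_eq_M interval_measure_cdf[OF M] by (simp add: quantile_def[abs_def] F)
qed

lemma finite_second_moment_quantile:
  assumes "is_cdf F"
  shows "finite_second_moment F \<longleftrightarrow> integrable uniform01 (\<lambda>t. (quantile F t)\<^sup>2)"
  unfolding finite_second_moment_def distr_quantile[OF assms, symmetric]
  by (rule integrable_distr_eq[OF quantile_measurable[OF assms]]) simp

lemma integrable_quantile:
  assumes "is_cdf F" "finite_second_moment F"
  shows "integrable uniform01 (quantile F)"
  using uniform01.square_integrable_imp_integrable[OF quantile_measurable[OF assms(1)]] assms(2)
  unfolding finite_second_moment_quantile[OF assms(1)] by simp

lemma cdf_mean_quantile:
  assumes "is_cdf F"
  shows "cdf_mean F = uniform01.expectation (quantile F)"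
  unfolding cdf_mean_def distr_quantile[OF assms, symmetric]
  by (rule integral_distr[OF quantile_measurable[OF assms]]) simp

lemma cdf_variance_quantile:
  assumes "is_cdf F"
  shows "cdf_variance F = uniform01.variance (quantile F)"
  unfolding cdf_variance_def cdf_mean_def[symmetric] cdf_mean_quantile[OF assms]
  unfolding distr_quantile[OF assms, symmetric]
  by (rule integral_distr[OF quantile_measurable[OF assms]]) simp

lemma mean_variance_eq:
  "mean_variance F w \<gamma> = w * cdf_mean F + \<gamma> * w\<^sup>2 * cdf_variance F"
  by (simp add: mean_variance_def cdf_mean_def cdf_variance_def power_mult_distrib
      right_diff_distrib[symmetric])

lemma wasserstein2_le_iff:
  "wasserstein2 F G \<le> sqrt \<epsilon> \<longleftrightarrow>
    uniform01.expectation (\<lambda>t. (quantile F t - quantile G t)\<^sup>2) \<le> \<epsilon>"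
  by (simp add: wasserstein2_def set_lebesgue_integral_def integral_restrict_space)

section \<open>Weak duality\<close>

lemma (in prob_space) integrable_square_add:
  fixes X Y :: "'a \<Rightarrow> real"
  assumes "random_variable borel X" "random_variable borel Y"
    and "integrable M (\<lambda>t. (X t)\<^sup>2)" "integrable M (\<lambda>t. (Y t)\<^sup>2)"
  shows "integrable M (\<lambda>t. (X t + Y t)\<^sup>2)"
proof (rule Bochner_Integration.integrable_bound[where f = "\<lambda>t. 2 * (X t)\<^sup>2 + 2 * (Y t)\<^sup>2"])
  have "(x + y)\<^sup>2 \<le> 2 * x\<^sup>2 + 2 * y\<^sup>2" for x y :: real
    using zero_le_power2[of "x - y"] by (simp add: power2_eq_square algebra_simps)
  then show "AE t in M. norm ((X t + Y t)\<^sup>2) \<le> norm (2 * (X t)\<^sup>2 + 2 * (Y t)\<^sup>2)"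
    by auto
qed (use assms in auto)

text \<open>The gap is a square divided by \<open>l - \<gamma>\<close>. It vanishes when
  \<open>y = \<gamma> / (l - \<gamma>) * x\<close>, which dictates the shape of the extremal
  distribution.\<close>

lemma square_add_le_weighted:
  fixes x y :: real
  assumes "0 < \<gamma>" "\<gamma> < l"
  shows "\<gamma> * (x + y)\<^sup>2 \<le> l * \<gamma> / (l - \<gamma>) * x\<^sup>2 + l * y\<^sup>2"
proof -
  have "l * \<gamma> / (l - \<gamma>) * x\<^sup>2 + l * y\<^sup>2 - \<gamma> * (x + y)\<^sup>2 = (\<gamma> * x - (l - \<gamma>) * y)\<^sup>2 / (l - \<gamma>)"
    using assms by (simp add: field_simps power2_eq_square)
  also have "\<dots> \<ge> 0"
    using assms by simp
  finally show ?thesis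
    by simp
qed

lemma (in prob_space) mean_variance_weak_duality:
  fixes X Y :: "'a \<Rightarrow> real"
  assumes [measurable]: "random_variable borel X" "random_variable borel Y"
    and X: "integrable M (\<lambda>t. (X t)\<^sup>2)" and Y: "integrable M (\<lambda>t. (Y t)\<^sup>2)"
    and \<gamma>: "0 < \<gamma>" "\<gamma> < l"
    and \<epsilon>: "expectation (\<lambda>t. (Y t - X t)\<^sup>2) \<le> \<epsilon>"
  shows "w * expectation Y + \<gamma> * w\<^sup>2 * variance Y
    \<le> (l * \<gamma> / (l - \<gamma>) * variance X + l * \<epsilon>) * w\<^sup>2 + expectation X * w + 1 / (4 * l)"
proof -
  have [simp]: "integrable M X" "integrable M Y"
    using assms square_integrable_imp_integrable by blast+
  define A where "A = expectation Y - expectation X"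
  have H: "integrable M (\<lambda>t. (Y t - X t)\<^sup>2)"
    using integrable_square_add[of Y "\<lambda>t. - X t"] X Y by simp
  \<comment> \<open>The transport budget splits: \<open>A\<close> squared is spent on moving the
    mean, and at most the rest on the variance of the displacement.\<close>
  have var_diff: "variance (\<lambda>t. Y t - X t) = expectation (\<lambda>t. (Y t - X t)\<^sup>2) - A\<^sup>2"
    by (subst variance_eq) (auto simp: H A_def)
  have sq: "integrable M (\<lambda>t. (Z t - c)\<^sup>2)"
    if "random_variable borel Z" "integrable M (\<lambda>t. (Z t)\<^sup>2)" for Z :: "'a \<Rightarrow> real" and c
    using integrable_square_add[of Z "\<lambda>t. - c"] that by simp
  have "\<gamma> * variance Y = expectation (\<lambda>t. \<gamma> * (Y t - expectation Y)\<^sup>2)"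
    by simp
  also have "\<dots> \<le> expectation (\<lambda>t. l * \<gamma> / (l - \<gamma>) * (X t - expectation X)\<^sup>2
      + l * ((Y t - X t) - expectation (\<lambda>t. Y t - X t))\<^sup>2)"
  proof (rule integral_mono)
    fix t
    show "\<gamma> * (Y t - expectation Y)\<^sup>2 \<le> l * \<gamma> / (l - \<gamma>) * (X t - expectation X)\<^sup>2
      + l * ((Y t - X t) - expectation (\<lambda>t. Y t - X t))\<^sup>2"
      using square_add_le_weighted[OF \<gamma>, of "X t - expectation X" "(Y t - X t) - A"]
      by (simp add: A_def algebra_simps)
  qed (intro integrable_mult_right Bochner_Integration.integrable_add sq X Y H; measurable)+
  also have "\<dots> = l * \<gamma> / (l - \<gamma>) * variance X + l * variance (\<lambda>t. Y t - X t)"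
    by (subst Bochner_Integration.integral_add)
      (auto intro!: integrable_mult_right sq X H simp del: Bochner_Integration.integral_diff)
  also have "\<dots> \<le> l * \<gamma> / (l - \<gamma>) * variance X + l * (\<epsilon> - A\<^sup>2)"
    unfolding var_diff using \<gamma> \<epsilon> by (intro add_left_mono mult_left_mono) auto
  finally have "\<gamma> * variance Y * w\<^sup>2 \<le> (l * \<gamma> / (l - \<gamma>) * variance X + l * (\<epsilon> - A\<^sup>2)) * w\<^sup>2"
    by (rule mult_right_mono) simp
  \<comment> \<open>Completing the square in \<open>A\<close>: the gain from the mean shift, less
    its cost, is at most \<open>1 / (4 * l)\<close>, with equality at
    \<open>A = 1 / (2 * l * w)\<close> if \<open>w\<close> is nonzero.\<close>
  moreover have "w * A - l * w\<^sup>2 * A\<^sup>2 = 1 / (4 * l) - (2 * l * w * A - 1)\<^sup>2 / (4 * l)"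
    using \<gamma> by (simp add: field_simps power2_eq_square)
  moreover have "(2 * l * w * A - 1)\<^sup>2 / (4 * l) \<ge> 0"
    using \<gamma> by simp
  ultimately show ?thesis
    by (simp add: A_def algebra_simps)
qed

lemma mean_variance_le_dual:
  assumes "is_cdf G" "finite_second_moment G" "F \<in> wasserstein_ball G \<epsilon>" "0 < \<gamma>" "\<gamma> < l"
  shows "mean_variance F w \<gamma>
    \<le> (l * \<gamma> / (l - \<gamma>) * cdf_variance G + l * \<epsilon>) * w\<^sup>2 + cdf_mean G * w + 1 / (4 * l)"
proof -
  have F: "is_cdf F" "finite_second_moment F" "wasserstein2 F G \<le> sqrt \<epsilon>"
    using assms(3) by (auto simp: wasserstein_ball_def)
  show ?thesis
    unfolding mean_variance_eq cdf_mean_quantile[OF F(1)] cdf_variance_quantile[OF F(1)]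
      cdf_mean_quantile[OF assms(1)] cdf_variance_quantile[OF assms(1)]
    using F assms quantile_measurable
    by (intro uniform01.mean_variance_weak_duality)
      (simp_all add: wasserstein2_le_iff finite_second_moment_quantile)
qed

section \<open>Affine images of the center and attainment of the dual bound\<close>

lemma affine_cdf:
  assumes G: "is_cdf G" and "0 < a"
  shows "is_cdf (\<lambda>x. G ((x - b) / a))"
proof -
  obtain M where M: "real_distribution M" and G': "G = cdf M"
    using assms by (auto simp: is_cdf_def)
  interpret real_distribution M by fact
  have "(\<lambda>x. a * x + b) -` {..x} \<inter> space M = {..(x - b) / a}" for x
    using \<open>0 < a\<close> by (auto simp: field_simps)
  then have "G ((x - b) / a) = cdf (distr M borel (\<lambda>x. a * x + b)) x" for x
    by (simp add: cdf_def measure_distr G')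
  then have "(\<lambda>x. G ((x - b) / a)) = cdf (distr M borel (\<lambda>x. a * x + b))"
    by blast
  moreover have "real_distribution (distr M borel (\<lambda>x. a * x + b))"
    by simp
  ultimately show ?thesis
    unfolding is_cdf_def by blast
qed

text \<open>By \<open>quantile_le_iff\<close> both sides have the same upper bounds, hence they
  coincide.\<close>

lemma quantile_affine:
  assumes "is_cdf G" "0 < a" "t \<in> {0<..<1}"
  shows "quantile (\<lambda>x. G ((x - b) / a)) t = a * quantile G t + b"
proof -
  have "quantile (\<lambda>x. G ((x - b) / a)) t \<le> x \<longleftrightarrow> quantile G t \<le> (x - b) / a" for x
    using assms by (simp add: quantile_le_iff affine_cdf)
  also have "quantile G t \<le> (x - b) / a \<longleftrightarrow> a * quantile G t + b \<le> x" for x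
    using assms(2) by (simp add: field_simps)
  finally have "quantile (\<lambda>x. G ((x - b) / a)) t \<le> x \<longleftrightarrow> a * quantile G t + b \<le> x" for x .
  then show ?thesis
    by (metis order.refl order.antisym)
qed

lemma affine_cdf_moments:
  fixes a b :: real
  assumes G: "is_cdf G" "finite_second_moment G" and a: "0 < a"
  defines "F \<equiv> \<lambda>x. G ((x - b) / a)"
  shows "finite_second_moment F"
    and "cdf_mean F = a * cdf_mean G + b"
    and "cdf_variance F = a\<^sup>2 * cdf_variance G"
    and "uniform01.expectation (\<lambda>t. (quantile F t - quantile G t)\<^sup>2)
      = (a - 1)\<^sup>2 * cdf_variance G + (cdf_mean F - cdf_mean G)\<^sup>2"
proof -
  have F: "is_cdf F"
    unfolding F_def using affine_cdf G a by blast
  note [measurable] = quantile_measurable[OF G(1)] quantile_measurable[OF F]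
  have q: "quantile F t = a * quantile G t + b" if "0 < t" "t < 1" for t
    using that quantile_affine[OF G(1) a] by (simp add: F_def)
  have int: "integrable uniform01 (quantile G)" "integrable uniform01 (\<lambda>t. (quantile G t)\<^sup>2)"
    using G integrable_quantile finite_second_moment_quantile by auto
  have int_aff: "integrable uniform01 (\<lambda>t. (c * quantile G t + d)\<^sup>2)" for c d
    using int by (intro uniform01.integrable_square_add) (auto simp: power_mult_distrib)
  show "finite_second_moment F"
    unfolding finite_second_moment_quantile[OF F]
    by (rule Bochner_Integration.integrable_cong[THEN iffD2, OF refl _ int_aff[of a b]])
      (simp add: q space_restrict_space)
  have "cdf_mean F = uniform01.expectation (\<lambda>t. a * quantile G t + b)"
    unfolding cdf_mean_quantile[OF F]
    by (rule Bochner_Integration.integral_cong) (simp_all add: q space_restrict_space)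
  then show mean: "cdf_mean F = a * cdf_mean G + b"
    using int uniform01.prob_space by (simp add: cdf_mean_quantile G)
  have "cdf_variance F = uniform01.expectation (\<lambda>t. (a * quantile G t + b - cdf_mean F)\<^sup>2)"
    unfolding cdf_variance_quantile[OF F] cdf_mean_quantile[OF F, symmetric]
    by (rule Bochner_Integration.integral_cong) (simp_all add: q space_restrict_space)
  also have "\<dots> = uniform01.expectation (\<lambda>t. a\<^sup>2 * (quantile G t - cdf_mean G)\<^sup>2)"
    by (rule Bochner_Integration.integral_cong) (simp_all add: mean power2_eq_square algebra_simps)
  finally show "cdf_variance F = a\<^sup>2 * cdf_variance G"
    by (simp add: cdf_variance_quantile G cdf_mean_quantile)
  \<comment> \<open>\<open>?D\<close> is the displacement
    \<open>quantile F t - quantile G t\<close>. Its second moment is its variance plus its squared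
    mean.\<close>
  let ?D = "\<lambda>t. (a - 1) * quantile G t + b"
  have ED: "uniform01.expectation ?D = cdf_mean F - cdf_mean G"
    using int uniform01.prob_space mean by (simp add: cdf_mean_quantile G algebra_simps)
  have "uniform01.variance ?D = uniform01.expectation (\<lambda>t. (a - 1)\<^sup>2 * (quantile G t - cdf_mean G)\<^sup>2)"
    unfolding ED
    by (rule Bochner_Integration.integral_cong) (simp_all add: mean power2_eq_square algebra_simps)
  also have "\<dots> = (a - 1)\<^sup>2 * cdf_variance G"
    by (simp add: cdf_variance_quantile G cdf_mean_quantile)
  finally have "uniform01.expectation (\<lambda>t. (?D t)\<^sup>2)
    = (a - 1)\<^sup>2 * cdf_variance G + (cdf_mean F - cdf_mean G)\<^sup>2"
    using uniform01.variance_eq[of ?D] int int_aff[of "a - 1" b] ED by simp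
  moreover have "uniform01.expectation (\<lambda>t. (quantile F t - quantile G t)\<^sup>2)
      = uniform01.expectation (\<lambda>t. (?D t)\<^sup>2)"
    by (rule Bochner_Integration.integral_cong) (simp_all add: q space_restrict_space algebra_simps)
  ultimately show "uniform01.expectation (\<lambda>t. (quantile F t - quantile G t)\<^sup>2)
      = (a - 1)\<^sup>2 * cdf_variance G + (cdf_mean F - cdf_mean G)\<^sup>2"
    by simp
qed

text \<open>The equation says that the extremal displacement uses up the budget: squared mean shift
  plus variance equals \<open>\<epsilon>\<close>. The left side tends to infinity as
  \<open>l\<close> decreases to \<open>\<gamma>\<close> and to 0 as \<open>l\<close> grows, so the
  intermediate value theorem applies.\<close>

lemma dual_multiplier_exists:
  fixes \<gamma> \<epsilon> w v :: real
  assumes "0 < \<gamma>" "0 < \<epsilon>" "0 < w" "0 < v"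
  obtains l where "\<gamma> < l" "(1 / (2 * l * w))\<^sup>2 + (\<gamma> / (l - \<gamma>))\<^sup>2 * v = \<epsilon>"
proof -
  define f where "f l = (1 / (2 * l * w))\<^sup>2 + (\<gamma> / (l - \<gamma>))\<^sup>2 * v" for l
  have "filterlim f at_top (at_right \<gamma>)"
    unfolding f_def using assms by real_asymp
  then have "eventually (\<lambda>l. f l \<ge> \<epsilon>) (at_right \<gamma>)"
    by (simp add: filterlim_at_top)
  then obtain c where c: "c > \<gamma>" "\<And>l. \<gamma> < l \<Longrightarrow> l < c \<Longrightarrow> f l \<ge> \<epsilon>"
    unfolding eventually_at_right[OF less_add_one[of \<gamma>]] by auto
  have "(f \<longlongrightarrow> 0) at_top"
    unfolding f_def using assms by real_asymp
  then have "eventually (\<lambda>l. f l < \<epsilon> \<and> c < l) at_top"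
    using assms by (intro eventually_conj order_tendstoD(2) eventually_gt_at_top)
  then obtain u where u: "f u < \<epsilon>" "c < u"
    by (auto simp: eventually_at_top_linorder)
  \<comment> \<open>The interval has to start away from the pole at \<open>\<gamma>\<close>, yet
    below \<open>c\<close>, where \<open>f\<close> is still at least
    \<open>\<epsilon>\<close>.\<close>
  define m where "m = (\<gamma> + c) / 2"
  have m: "\<gamma> < m" "m < c"
    using c by (auto simp: m_def)
  have "continuous_on {m..u} f"
    unfolding f_def using m assms by (intro continuous_intros) auto
  then obtain l where "m \<le> l" "l \<le> u" "f l = \<epsilon>"
    using IVT2'[of f u \<epsilon> m] c(2)[of m] m u by auto
  then show ?thesis
    using that[of l] m by (simp add: f_def)
qed

text \<open>The extremal distribution is the affine image of \<open>G\<close> under \<open>x \<mapsto> x + a + k (x - \<mu>)\<close>, where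
  \<open>a = 1 / (2 l w)\<close> and \<open>k = \<gamma> / (l - \<gamma>)\<close> turn both estimates of weak duality into equalities.\<close>

lemma mean_variance_dual_attained:
  assumes G: "is_cdf G" "finite_second_moment G" "0 < cdf_variance G"
    and pos: "0 < \<gamma>" "0 < \<epsilon>" "0 < w"
  obtains l F where "\<gamma> < l" "F \<in> wasserstein_ball G \<epsilon>" "0 < cdf_variance F"
    and "mean_variance F w \<gamma>
      = (l * \<gamma> / (l - \<gamma>) * cdf_variance G + l * \<epsilon>) * w\<^sup>2 + cdf_mean G * w + 1 / (4 * l)"
proof -
  obtain l where l: "\<gamma> < l" and eq: "(1 / (2 * l * w))\<^sup>2 + (\<gamma> / (l - \<gamma>))\<^sup>2 * cdf_variance G = \<epsilon>"
    using dual_multiplier_exists[OF pos G(3)] .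
  \<comment> \<open>Here \<open>a\<close> is the slope of the whole map, one plus the slope of the
    displacement. The offset in \<open>F\<close> makes the mean move by exactly
    \<open>1 / (2 * l * w)\<close>.\<close>
  define a where "a = l / (l - \<gamma>)"
  define F where "F = (\<lambda>x. G ((x - (1 / (2 * l * w) - (a - 1) * cdf_mean G)) / a))"
  have a: "0 < a" "a - 1 = \<gamma> / (l - \<gamma>)"
    using pos l by (auto simp: a_def field_simps)
  note F = affine_cdf_moments[OF G(1,2) a(1), of "1 / (2 * l * w) - (a - 1) * cdf_mean G",
      folded F_def]
  have mean: "cdf_mean F = cdf_mean G + 1 / (2 * l * w)"
    using F(2) by (simp add: algebra_simps)
  have "F \<in> wasserstein_ball G \<epsilon>"
    using F(1,4) affine_cdf[OF G(1) a(1)] eq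
    by (simp add: wasserstein_ball_def wasserstein2_le_iff mean a add.commute) (simp add: F_def)
  moreover have "0 < cdf_variance F"
    using F(3) G a by simp
  moreover have "mean_variance F w \<gamma>
      = (l * \<gamma> / (l - \<gamma>) * cdf_variance G + l * \<epsilon>) * w\<^sup>2 + cdf_mean G * w + 1 / (4 * l)"
    unfolding mean_variance_eq F(3) mean eq[symmetric] a_def using l pos
    by (simp add: divide_simps) (simp add: power2_eq_square algebra_simps)
  ultimately show thesis
    using that l by blast
qed

section \<open>The worst-case value in one coordinate\<close>

locale uncertain_loss =
  fixes G :: "real \<Rightarrow> real" and \<epsilon> \<gamma> :: real
  assumes cdf: "is_cdf G"
    and second_moment: "finite_second_moment G"
    and variance_pos: "0 < cdf_variance G"
    and \<epsilon>_pos: "0 < \<epsilon>"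
    and \<gamma>_pos: "0 < \<gamma>"
begin

text \<open>A supremum of reals, legitimate by \<open>center_in_ball\<close> and
  \<open>bdd_above_mean_variance\<close>; \<open>ereal_robust_value\<close> links it to the extended
  real supremum.\<close>

definition robust_value :: "real \<Rightarrow> real" where
  "robust_value w = (SUP F\<in>wasserstein_ball G \<epsilon>. mean_variance F w \<gamma>)"

definition dual_value :: "real \<Rightarrow> real \<Rightarrow> real" where
  "dual_value l w =
    (l * \<gamma> / (l - \<gamma>) * cdf_variance G + l * \<epsilon>) * w\<^sup>2 + cdf_mean G * w + 1 / (4 * l)"

lemma center_in_ball: "G \<in> wasserstein_ball G \<epsilon>"
  using cdf second_moment \<epsilon>_pos by (simp add: wasserstein_ball_def wasserstein2_le_iff)

lemma mean_variance_le_dual_value: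
  "F \<in> wasserstein_ball G \<epsilon> \<Longrightarrow> \<gamma> < l \<Longrightarrow> mean_variance F w \<gamma> \<le> dual_value l w"
  unfolding dual_value_def using mean_variance_le_dual cdf second_moment \<gamma>_pos by blast

lemma bdd_above_mean_variance: "bdd_above ((\<lambda>F. mean_variance F w \<gamma>) ` wasserstein_ball G \<epsilon>)"
  using mean_variance_le_dual_value[of _ "\<gamma> + 1"] by (intro bdd_aboveI2) auto

lemma mean_variance_le_robust_value:
  "F \<in> wasserstein_ball G \<epsilon> \<Longrightarrow> mean_variance F w \<gamma> \<le> robust_value w"
  unfolding robust_value_def by (intro cSUP_upper bdd_above_mean_variance)

lemma robust_value_le_dual_value: "\<gamma> < l \<Longrightarrow> robust_value w \<le> dual_value l w"
  unfolding robust_value_def using center_in_ball mean_variance_le_dual_value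
  by (intro cSUP_least) auto

lemma ereal_robust_value:
  "(SUP F\<in>wasserstein_ball G \<epsilon>. ereal (mean_variance F w \<gamma>)) = ereal (robust_value w)"
proof (rule antisym)
  show "(SUP F\<in>wasserstein_ball G \<epsilon>. ereal (mean_variance F w \<gamma>)) \<le> ereal (robust_value w)"
    by (intro SUP_least) (simp add: mean_variance_le_robust_value)
  \<comment> \<open>The center excludes the value minus infinity in the case analysis below; plus
    infinity is trivial.\<close>
  have "ereal (mean_variance G w \<gamma>) \<le> (SUP F\<in>wasserstein_ball G \<epsilon>. ereal (mean_variance F w \<gamma>))"
    by (intro SUP_upper center_in_ball)
  moreover have "ereal (mean_variance F w \<gamma>)
      \<le> (SUP F\<in>wasserstein_ball G \<epsilon>. ereal (mean_variance F w \<gamma>))"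
    if "F \<in> wasserstein_ball G \<epsilon>" for F
    using that by (intro SUP_upper)
  ultimately show "ereal (robust_value w) \<le> (SUP F\<in>wasserstein_ball G \<epsilon>. ereal (mean_variance F w \<gamma>))"
    unfolding robust_value_def using center_in_ball
    by (cases "SUP F\<in>wasserstein_ball G \<epsilon>. ereal (mean_variance F w \<gamma>)")
      (auto intro!: cSUP_least)
qed

text \<open>\<open>robust_value w\<close> lies between \<open>mean_variance F w \<gamma>\<close> and
  \<open>dual_value l w\<close>, which agree for the extremal pair.\<close>

lemma robust_value_attained:
  assumes "0 < w"
  obtains l F where "\<gamma> < l" "F \<in> wasserstein_ball G \<epsilon>" "0 < cdf_variance F"
    and "robust_value w = mean_variance F w \<gamma>" "robust_value w = dual_value l w"
proof -
  obtain l F where l: "\<gamma> < l" and F: "F \<in> wasserstein_ball G \<epsilon>" "0 < cdf_variance F"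
    and eq: "mean_variance F w \<gamma> = dual_value l w"
    unfolding dual_value_def
    using mean_variance_dual_attained[OF cdf second_moment variance_pos \<gamma>_pos \<epsilon>_pos assms] .
  then show thesis
    using that mean_variance_le_robust_value[OF F(1), of w] robust_value_le_dual_value[OF l, of w]
    by fastforce
qed

text \<open>The slack \<open>e\<close> serves the case \<open>w = 0\<close>: there the dual value is
  \<open>1 / (4 * l)\<close>, whose infimum is not attained. For positive \<open>w\<close> the bound
  is exact.\<close>

lemma dual_value_approx:
  assumes "0 \<le> w" "0 < e"
  obtains l where "\<gamma> < l" "dual_value l w \<le> robust_value w + e"
proof (cases "w = 0")
  case True
  define l where "l = max (\<gamma> + 1) (1 / (4 * e))"
  have l: "\<gamma> < l" "0 < l" "1 / (4 * e) \<le> l"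
    using \<gamma>_pos by (auto simp: l_def)
  then have "1 / (4 * l) \<le> e"
    using \<open>0 < e\<close> by (simp add: field_simps)
  moreover have "0 \<le> robust_value 0"
    using mean_variance_le_robust_value[OF center_in_ball, of 0] by (simp add: mean_variance_eq)
  ultimately show ?thesis
    using that[of l] l True by (simp add: dual_value_def)
next
  case False
  then show ?thesis
    using that robust_value_attained[of w] assms by (metis add_increasing2 less_le order.refl)
qed

lemma robust_value_midpoint_less:
  assumes "0 \<le> u" "0 \<le> v" "u \<noteq> v"
  shows "robust_value ((u + v) / 2) < (robust_value u + robust_value v) / 2"
proof -
  \<comment> \<open>Even if one end point is 0, the midpoint is positive, so an extremal
    distribution exists there.\<close>
  have "0 < (u + v) / 2"
    using assms by (cases u v rule: linorder_cases) auto
  then obtain F where F: "F \<in> wasserstein_ball G \<epsilon>" "0 < cdf_variance F"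
    and eq: "robust_value ((u + v) / 2) = mean_variance F ((u + v) / 2) \<gamma>"
    using robust_value_attained by metis
  \<comment> \<open>The convexity defect of the square at the midpoint, \<open>(u - v)\<close>
    squared over 4, scaled by \<open>\<gamma>\<close> times the variance.\<close>
  define d where "d = \<gamma> * cdf_variance F * (u - v)\<^sup>2 / 4"
  have "0 < d"
    using F \<gamma>_pos assms by (simp add: d_def)
  have "robust_value ((u + v) / 2) = (mean_variance F u \<gamma> + mean_variance F v \<gamma>) / 2 - d"
    unfolding eq by (simp add: mean_variance_eq d_def power2_eq_square field_simps)
  also have "\<dots> < (mean_variance F u \<gamma> + mean_variance F v \<gamma>) / 2"
    using \<open>0 < d\<close> by (simp only: diff_less_eq less_add_same_cancel1)
  also have "\<dots> \<le> (robust_value u + robust_value v) / 2"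
    using F(1) by (intro divide_right_mono add_mono mean_variance_le_robust_value) auto
  finally show ?thesis .
qed

end

section \<open>The joint problem over the simplex\<close>

lemma sum_quadratic_completed:
  fixes c w :: "'n \<Rightarrow> real"
  assumes "finite I" "\<And>i. i \<in> I \<Longrightarrow> 0 < c i" "(\<Sum>i\<in>I. w i) = 1"
  defines "K \<equiv> inverse (\<Sum>i\<in>I. 1 / c i)"
  shows "(\<Sum>i\<in>I. c i * (w i)\<^sup>2) = K + (\<Sum>i\<in>I. c i * (w i - K / c i)\<^sup>2)"
proof -
  have "I \<noteq> {}"
    using assms(3) by auto
  then have "0 < (\<Sum>i\<in>I. 1 / c i)"
    using assms by (intro sum_pos) auto
  then have K: "K * (\<Sum>i\<in>I. 1 / c i) = 1"
    by (simp add: K_def)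
  \<comment> \<open>\<open>K / c i\<close> is the constrained minimizer and \<open>K\<close> the
    minimum. After summation the cross term is \<open>-2 * K\<close>, as the weights sum to one, and
    the constant term is \<open>K\<close>.\<close>
  have "c i * (w i - K / c i)\<^sup>2 = c i * (w i)\<^sup>2 - 2 * K * w i + K\<^sup>2 * (1 / c i)" if "i \<in> I" for i
    using assms(2)[OF that] by (simp add: power2_eq_square field_simps)
  then have "(\<Sum>i\<in>I. c i * (w i - K / c i)\<^sup>2)
    = (\<Sum>i\<in>I. c i * (w i)\<^sup>2) - 2 * K * (\<Sum>i\<in>I. w i) + K\<^sup>2 * (\<Sum>i\<in>I. 1 / c i)"
    by (simp add: sum.distrib sum_subtractf sum_distrib_left)
  also have "K\<^sup>2 * (\<Sum>i\<in>I. 1 / c i) = K"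
    using K by (simp add: power2_eq_square mult.assoc)
  finally show ?thesis
    using assms(3) by simp
qed

theorem proposition4p1:
  fixes G :: "'n::finite \<Rightarrow> real \<Rightarrow> real"
    and \<gamma> \<epsilon> \<mu> \<sigma> :: "real ^ 'n"
  assumes "\<And>i. \<gamma> $ i > 0"
    and "\<And>i. \<epsilon> $ i > 0"
    and "\<And>i. is_cdf (G i)"
    and "\<And>i. finite_second_moment (G i)"
    and "\<And>i. cdf_mean (G i) = \<mu> $ i"
    and "\<And>i. cdf_variance (G i) = (\<sigma> $ i)\<^sup>2"
    and "\<And>i. (\<sigma> $ i)\<^sup>2 > 0"
  shows "(INF w\<in>simplex_weights. worst_case_objective G \<epsilon> \<gamma> w)
         = (INF l\<in>above \<gamma>. INF w\<in>simplex_weights.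
              ereal (\<Sum>i\<in>UNIV. dual_coeff \<gamma> \<epsilon> \<sigma> l i * (w $ i)\<^sup>2 + \<mu> $ i * w $ i + 1 / (4 * l $ i)))
       \<and> (\<forall>m ls. (\<forall>i. \<mu> $ i = m) \<longrightarrow>
            is_arg_min
              (\<lambda>l. inverse (\<Sum>k\<in>UNIV. 1 / dual_coeff \<gamma> \<epsilon> \<sigma> l k) + (\<Sum>k\<in>UNIV. 1 / (4 * l $ k)))
              (\<lambda>l. l \<in> above \<gamma>) ls \<longrightarrow>
            (\<forall>w. is_arg_min (worst_case_objective G \<epsilon> \<gamma>) (\<lambda>w. w \<in> simplex_weights) w \<longleftrightarrow>
                 w = (\<chi> i. inverse (dual_coeff \<gamma> \<epsilon> \<sigma> ls i)
                           / (\<Sum>k\<in>UNIV. inverse (dual_coeff \<gamma> \<epsilon> \<sigma> ls k)))))"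
proof -
  interpret U: uncertain_loss "G i" "\<epsilon> $ i" "\<gamma> $ i" for i
    using assms by unfold_locales simp_all
  let ?c = "dual_coeff \<gamma> \<epsilon> \<sigma>"
  define R where "R w = (\<Sum>i\<in>UNIV. U.robust_value i (w $ i))" for w :: "real ^ 'n"
  define D where
    "D l w = (\<Sum>i\<in>UNIV. ?c l i * (w $ i)\<^sup>2 + \<mu> $ i * w $ i + 1 / (4 * l $ i))" for l w
  define H where "H l = inverse (\<Sum>k\<in>UNIV. 1 / ?c l k) + (\<Sum>k\<in>UNIV. 1 / (4 * l $ k))" for l
  have obj: "worst_case_objective G \<epsilon> \<gamma> w = ereal (R w)" for w
    by (simp add: worst_case_objective_def U.ereal_robust_value R_def)
  have D: "D l w = (\<Sum>i\<in>UNIV. U.dual_value i (l $ i) (w $ i))" for l w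
    by (simp add: D_def U.dual_value_def dual_coeff_def assms(5,6))
  have R_le_D: "R w \<le> D l w" if "l \<in> above \<gamma>" for l w
    using that unfolding R_def D above_def
    by (intro sum_mono U.robust_value_le_dual_value) auto
  have approx: "\<exists>l\<in>above \<gamma>. D l w \<le> R w + e" if w: "w \<in> simplex_weights" and "0 < e" for w e
  proof -
    \<comment> \<open>The error is shared equally among the coordinates, whose multipliers can be
      chosen independently.\<close>
    have e: "0 < e / CARD('n)"
      using \<open>0 < e\<close> by simp
    have "\<exists>l. \<gamma> $ i < l \<and> U.dual_value i l (w $ i) \<le> U.robust_value i (w $ i) + e / CARD('n)" for i
    proof -
      have "0 \<le> w $ i"
        using w by (simp add: simplex_weights_def)
      then show ?thesis
        using U.dual_value_approx[OF _ e] by metis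
    qed
    then obtain l where l: "\<And>i. \<gamma> $ i < l i"
      "\<And>i. U.dual_value i (l i) (w $ i) \<le> U.robust_value i (w $ i) + e / CARD('n)"
      by metis
    have "D (\<chi> i. l i) w \<le> (\<Sum>i\<in>UNIV. U.robust_value i (w $ i) + e / CARD('n))"
      unfolding D using l(2) by (intro sum_mono) simp
    also have "\<dots> = R w + e"
      by (simp add: sum.distrib R_def)
    finally show ?thesis
      using l(1) by (intro bexI[of _ "\<chi> i. l i"]) (simp_all add: above_def)
  qed
  have obj_INF: "worst_case_objective G \<epsilon> \<gamma> w = (INF l\<in>above \<gamma>. ereal (D l w))"
    if w: "w \<in> simplex_weights" for w
    unfolding obj
  proof (rule antisym)
    show "ereal (R w) \<le> (INF l\<in>above \<gamma>. ereal (D l w))"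
      by (intro INF_greatest) (simp add: R_le_D)
    show "(INF l\<in>above \<gamma>. ereal (D l w)) \<le> ereal (R w)"
    proof (rule ereal_le_epsilon2)
      fix e :: real
      assume "0 < e"
      then obtain l where "l \<in> above \<gamma>" "D l w \<le> R w + e"
        using approx[OF w] by blast
      then show "(INF l\<in>above \<gamma>. ereal (D l w)) \<le> ereal (R w) + ereal e"
        by (intro INF_lower2) auto
    qed
  qed
  have inf_eq: "(INF w\<in>simplex_weights. worst_case_objective G \<epsilon> \<gamma> w)
      = (INF l\<in>above \<gamma>. INF w\<in>simplex_weights. ereal (D l w))"
    by (subst INF_commute) (simp add: obj_INF)
  have argmin: "is_arg_min (worst_case_objective G \<epsilon> \<gamma>) (\<lambda>w. w \<in> simplex_weights) w \<longleftrightarrow>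
      w = (\<chi> i. inverse (?c ls i) / (\<Sum>k\<in>UNIV. inverse (?c ls k)))"
    if \<mu>: "\<forall>i. \<mu> $ i = m" and ls: "is_arg_min H (\<lambda>l. l \<in> above \<gamma>) ls" for m ls w
  proof -
    define ws :: "real ^ 'n" where "ws = (\<chi> i. inverse (?c ls i) / (\<Sum>k\<in>UNIV. inverse (?c ls k)))"
    have c_pos: "0 < ?c l i" if "l \<in> above \<gamma>" for l i
    proof -
      have "0 < \<gamma> $ i" "\<gamma> $ i < l $ i" "0 < \<epsilon> $ i" "0 < (\<sigma> $ i)\<^sup>2"
        using that assms by (auto simp: above_def)
      then show ?thesis
        unfolding dual_coeff_def by (intro add_pos_pos mult_pos_pos divide_pos_pos) auto
    qed
    \<comment> \<open>With equal means the linear term is constantly \<open>m\<close> on the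
      simplex, so for fixed \<open>l\<close> the minimum over \<open>w\<close> is
      \<open>m + H l\<close>, up to attainment of the zero of the squares.\<close>
    have D_eq: "D l w = m + H l + (\<Sum>i\<in>UNIV. ?c l i * (w $ i - inverse (\<Sum>k\<in>UNIV. 1 / ?c l k) / ?c l i)\<^sup>2)"
      if "l \<in> above \<gamma>" "w \<in> simplex_weights" for l w
    proof -
      have w1: "(\<Sum>i\<in>UNIV. w $ i) = 1"
        using that by (simp add: simplex_weights_def)
      show ?thesis
        using sum_quadratic_completed[of UNIV "?c l" "\<lambda>i. w $ i"] c_pos[OF that(1)] w1 \<mu>
        by (simp add: D_def H_def sum.distrib sum_distrib_left[symmetric])
    qed
    have ls_above: "ls \<in> above \<gamma>" and ls_min: "\<And>l. l \<in> above \<gamma> \<Longrightarrow> H ls \<le> H l"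
      using ls by (auto simp: is_arg_min_linorder)
    have pos: "0 < (\<Sum>k\<in>UNIV. inverse (?c ls k))"
      using c_pos[OF ls_above] by (intro sum_pos) auto
    have ws: "ws \<in> simplex_weights"
      using c_pos[OF ls_above] pos less_imp_le[OF c_pos[OF ls_above]]
      by (auto simp: simplex_weights_def ws_def sum_divide_distrib[symmetric])
    \<comment> \<open>For \<open>l = ls\<close> all squares in \<open>D_eq\<close> vanish at
      \<open>ws\<close>.\<close>
    have "R ws \<le> m + H ls"
      using R_le_D[OF ls_above, of ws] D_eq[OF ls_above ws] by (simp add: ws_def field_simps)
    \<comment> \<open>A nearly optimal \<open>l\<close> for \<open>w\<close> gives
      \<open>R w + e\<close> at least \<open>D l w\<close>, hence at least \<open>m + H l\<close>,
      and \<open>ls\<close> minimizes \<open>H\<close>.\<close>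
    moreover have lower: "m + H ls \<le> R w" if w: "w \<in> simplex_weights" for w
    proof (rule field_le_epsilon)
      fix e :: real
      assume "0 < e"
      then obtain l where l: "l \<in> above \<gamma>" "D l w \<le> R w + e"
        using approx[OF w] by blast
      have "0 \<le> (\<Sum>i\<in>UNIV. ?c l i * (w $ i - inverse (\<Sum>k\<in>UNIV. 1 / ?c l k) / ?c l i)\<^sup>2)"
        using less_imp_le[OF c_pos[OF l(1)]] by (intro sum_nonneg) simp
      then show "m + H ls \<le> R w + e"
        using D_eq[OF l(1) w] l ls_min by fastforce
    qed
    ultimately have ws_min: "R ws \<le> R w" if "w \<in> simplex_weights" for w
      using that by (meson order_trans)
    have unique: "w = ws" if w: "w \<in> simplex_weights" and le: "R w \<le> R ws" for w
    proof (rule ccontr)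
      assume "w \<noteq> ws"
      then obtain j where j: "w $ j \<noteq> ws $ j"
        by (auto simp: vec_eq_iff)
      \<comment> \<open>The midpoint of two distinct optima would beat both: coordinates that agree
        contribute equality, and coordinate \<open>j\<close> a strict gain.\<close>
      define u :: "real ^ 'n" where "u = (\<chi> i. (w $ i + ws $ i) / 2)"
      have u: "u \<in> simplex_weights"
        using w ws by (auto simp: simplex_weights_def u_def sum_divide_distrib[symmetric] sum.distrib)
      have less: "U.robust_value i (u $ i) < (U.robust_value i (w $ i) + U.robust_value i (ws $ i)) / 2"
        if "w $ i \<noteq> ws $ i" for i
        using U.robust_value_midpoint_less that w ws by (simp add: u_def simplex_weights_def)
      moreover have "U.robust_value i (u $ i) \<le> (U.robust_value i (w $ i) + U.robust_value i (ws $ i)) / 2" for i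
        using less[of i] by (cases "w $ i = ws $ i") (auto simp: u_def)
      ultimately have "R u < (\<Sum>i\<in>UNIV. (U.robust_value i (w $ i) + U.robust_value i (ws $ i)) / 2)"
        unfolding R_def using j by (intro sum_strict_mono_ex1) auto
      also have "\<dots> = (R w + R ws) / 2"
        by (simp add: R_def sum.distrib sum_divide_distrib[symmetric])
      also have "\<dots> \<le> R ws"
        using le by simp
      finally show False
        using ws_min[OF u] by simp
    qed
    show ?thesis
      unfolding ws_def[symmetric] is_arg_min_linorder obj
      using ws ws_min unique by auto
  qed
  show ?thesis
    using inf_eq argmin unfolding D_def H_def by blast
qed

end
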